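(* Let ${\tt f}=f_0f_1f_2\cdots$ be the Fibonacci word. Then: (a) $\Delta p_{\tt a}$ is the sequence obtained from ${\tt f}$ under the coding ${\tt a}\mapsto2,\ {\tt b}\mapsto1$, i.e. $\Delta p_{\tt a}(n)=2$ if $f_{n-1}={\tt a}$ and $\Delta p_{\tt a}(n)=1$ if $f_{n-1}={\tt b}$; (b) $\Delta p_{\tt b}$ is the sequence obtained from ${\tt f}$ under the coding ${\tt a}\mapsto3,\ {\tt b}\mapsto2$; (c) $r(n)=n$ for all $n\geqslant1$ and $\Delta r(n)=1$ for all $n$; in particular $\Delta r$ is periodic.
   Context: The Fibonacci word ${\tt f}={\tt a}{\tt b}{\tt a}{\tt a}{\tt b}{\tt a}{\tt b}{\tt a}\cdots=\lim_{n\to\infty}\varrho_F^n({\tt a})$ is the fixed point of the substitution $\varrho_F:{\tt a}\mapsto{\tt a}{\tt b},\ {\tt b}\mapsto{\tt a}$, indexed from position $0$. For $n\geqslant1$, $p_{\tt a}(n)$ (resp. $p_{\tt b}(n)$) is the position of the $n$-th occurrence of ${\tt a}$ (resp. ${\tt b}$) in ${\tt f}$, $r(n)=p_{\tt b}(n)-p_{\tt a}(n)$, and $\Delta s(n)=s(n+1)-s(n)$ for any sequence $s$. *)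

theory Defs
  imports Complex_Main "HOL-Library.Infinite_Set"
begin

datatype letter = La | Lb

fun fib_subst :: "letter \<Rightarrow> letter list" where
  "fib_subst La = [La, Lb]"
| "fib_subst Lb = [La]"

definition subst_word :: "('a \<Rightarrow> 'a list) \<Rightarrow> 'a list \<Rightarrow> 'a list" where
  "subst_word \<rho> w = concat (map \<rho> w)"

(* Limit of finite words in the topology of finite and infinite words: every letter is eventually
   defined and constant. The THE is only meaningful if the limit exists and is infinite;
   see fib_word_nth below for the case at hand. *)
definition word_limit :: "(nat \<Rightarrow> 'a list) \<Rightarrow> nat \<Rightarrow> 'a" where
  "word_limit w i = (THE c. \<forall>\<^sub>F n in sequentially. i < length (w n) \<and> w n ! i = c)"

definition fib_word :: "nat \<Rightarrow> letter" where
  "fib_word = word_limit (\<lambda>n. (subst_word fib_subst ^^ n) [La])"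

(* Positions count from 0, occurrences from 1; the value at n = 0 is irrelevant. *)
definition occ_pos :: "letter \<Rightarrow> nat \<Rightarrow> int" where
  "occ_pos c n = int (enumerate {i. fib_word i = c} (n - 1))"

abbreviation p_a :: "nat \<Rightarrow> int" where "p_a \<equiv> occ_pos La"

abbreviation p_b :: "nat \<Rightarrow> int" where "p_b \<equiv> occ_pos Lb"

definition r :: "nat \<Rightarrow> int" where
  "r n = p_b n - p_a n"

definition Delta :: "(nat \<Rightarrow> int) \<Rightarrow> nat \<Rightarrow> int" where
  "Delta s n = s (n + 1) - s n"

(* Pure periodicity of a sequence indexed by n = 1, 2, 3, ... *)
definition periodic_seq :: "(nat \<Rightarrow> 'a) \<Rightarrow> bool" where
  "periodic_seq s \<longleftrightarrow> (\<exists>T>0. \<forall>n\<ge>1. s (n + T) = s n)"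

lemma subst_word_append: "subst_word \<rho> (u @ v) = subst_word \<rho> u @ subst_word \<rho> v"
  by (simp add: subst_word_def)

abbreviation fib_iter :: "nat \<Rightarrow> letter list" where
  "fib_iter n \<equiv> (subst_word fib_subst ^^ n) [La]"

lemma fib_iter_rec: "fib_iter (Suc (Suc n)) = fib_iter (Suc n) @ fib_iter n"
proof (induction n)
  case 0
  show ?case by (simp add: subst_word_def)
next
  case (Suc n)
  have "fib_iter (Suc (Suc (Suc n))) = subst_word fib_subst (fib_iter (Suc (Suc n)))"
    by simp
  also have "\<dots> = subst_word fib_subst (fib_iter (Suc n) @ fib_iter n)"
    by (simp only: Suc.IH)
  finally show ?case by (simp add: subst_word_append)
qed

lemma fib_iter_Suc_prefix: "\<exists>v. fib_iter (Suc n) = fib_iter n @ v"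
proof (cases n)
  case 0
  then show ?thesis by (simp add: subst_word_def)
next
  case (Suc m)
  show ?thesis unfolding Suc fib_iter_rec by blast
qed

lemma fib_iter_prefix: "m \<le> n \<Longrightarrow> \<exists>v. fib_iter n = fib_iter m @ v"
proof (induction n rule: dec_induct)
  case (step n)
  then show ?case using fib_iter_Suc_prefix[of n] by (metis append.assoc)
qed simp

lemma length_fib_iter: "n < length (fib_iter n)"
proof (induction n rule: less_induct)
  case (less n)
  consider "n = 0" | "n = 1" | m where "n = Suc (Suc m)"
    by (metis One_nat_def not0_implies_Suc)
  then show ?case
  proof cases
    case 3
    with less[of m] less[of "Suc m"] show ?thesis
      unfolding 3 fib_iter_rec by simp
  qed (simp_all add: subst_word_def)
qed

lemma fib_word_nth:
  assumes "i < length (fib_iter m)"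
  shows "fib_word i = fib_iter m ! i"
proof -
  have ev: "\<forall>\<^sub>F n in sequentially. i < length (fib_iter n) \<and> fib_iter n ! i = fib_iter m ! i"
    using eventually_ge_at_top[of m]
  proof eventually_elim
    case (elim n)
    then show ?case using fib_iter_prefix[of m n] assms by (auto simp: nth_append)
  qed
  show ?thesis unfolding fib_word_def word_limit_def
  proof (rule the_equality)
    show "\<forall>\<^sub>F n in sequentially. i < length (fib_iter n) \<and> fib_iter n ! i = fib_iter m ! i"
      by (rule ev)
    fix c
    assume "\<forall>\<^sub>F n in sequentially. i < length (fib_iter n) \<and> fib_iter n ! i = c"
    with ev have "\<forall>\<^sub>F n in sequentially. c = fib_iter m ! i"
      by eventually_elim simp
    then show "c = fib_iter m ! i" by simp
  qed
qed

lemma fib_iter_eq: "fib_iter m = map fib_word [0..<length (fib_iter m)]"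
  by (rule nth_equalityI) (simp_all add: fib_word_nth)

lemma fib_word_fixed_point:
  "\<exists>l\<ge>n. subst_word fib_subst (map fib_word [0..<n]) = map fib_word [0..<l]"
proof -
  let ?P = "map fib_word [0..<n]"
  have "?P = take n (fib_iter n)"
    using length_fib_iter[of n] by (subst fib_iter_eq) (simp add: take_map)
  then obtain v where v: "fib_iter n = ?P @ v"
    by (metis append_take_drop_id)
  have "fib_iter (Suc n) = subst_word fib_subst ?P @ subst_word fib_subst v"
    by (simp add: v subst_word_append)
  then have "subst_word fib_subst ?P
      = take (length (subst_word fib_subst ?P)) (map fib_word [0..<length (fib_iter (Suc n))])"
    using fib_iter_eq[of "Suc n"] by (metis append_eq_conv_conj)
  moreover have "length (subst_word fib_subst ?P) \<le> length (fib_iter (Suc n))"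
    using \<open>fib_iter (Suc n) = _\<close> by simp
  ultimately have "subst_word fib_subst ?P = map fib_word [0..<length (subst_word fib_subst ?P)]"
    by (simp add: take_map)
  moreover have "length w \<le> length (subst_word fib_subst w)" for w
  proof (induction w)
    case (Cons c w)
    then show ?case by (cases c) (simp_all add: subst_word_def)
  qed simp
  then have "n \<le> length (subst_word fib_subst ?P)"
    by (metis diff_zero length_map length_upt)
  ultimately show ?thesis by blast
qed

lemma infinite_occurrences: "infinite {i. fib_word i = c}"
  unfolding infinite_nat_iff_unbounded_le
proof
  fix m
  define k where "k = length (fib_iter (Suc (Suc m)))"
  have k: "m \<le> k" using length_fib_iter[of "Suc (Suc m)"] by (simp add: k_def)
  obtain v where v: "fib_iter (Suc m) = [La, Lb] @ v"
    using fib_iter_prefix[of 1 "Suc m"] by (auto simp: subst_word_def)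
  have *: "fib_word (k + j) = ([La, Lb] @ v) ! j" if "j < 2" for j
  proof -
    have eq: "fib_iter (Suc (Suc (Suc m))) = fib_iter (Suc (Suc m)) @ ([La, Lb] @ v)"
      by (simp only: fib_iter_rec[of "Suc m"] v)
    show ?thesis
      using that fib_word_nth[of "k + j" "Suc (Suc (Suc m))"]
      unfolding eq by (simp add: k_def nth_append)
  qed
  show "\<exists>n\<ge>m. n \<in> {i. fib_word i = c}"
  proof (cases c)
    case La
    then show ?thesis using *[of 0] k by auto
  next
    case Lb
    then show ?thesis using *[of 1] k by (intro exI[of _ "k + 1"]) simp
  qed
qed

end

theory Submission
  imports Defs
begin

text \<open>Let \<open>L n\<close> be the length of the image under the substitution of the prefix of length \<open>n\<close> of
  the Fibonacci word. Every letter has an image starting with \<open>a\<close>, so the positions of \<open>a\<close> are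
  exactly the values of \<open>L\<close>. The letter \<open>b\<close> only occurs as second letter of the image of an \<open>a\<close>,
  so the positions of \<open>b\<close> are exactly the numbers \<open>L (L n) + 1\<close>. Finally \<open>L k\<close> is \<open>k\<close> plus the
  number of occurrences of \<open>a\<close> before position \<open>k\<close>, whence \<open>L (L n) = L n + n\<close>.\<close>

text \<open>Turns a description of the positions of a letter as \<open>range g\<close> into a
  formula for its n-th occurrence.\<close>

lemma enumerate_range_strict_mono:
  fixes g :: "nat \<Rightarrow> nat"
  assumes "strict_mono g"
  shows "enumerate (range g) n = g n"
proof (induction n)
  case 0
  show ?case
    unfolding enumerate_0
    by (rule Least_equality) (auto simp: strict_mono_less_eq[OF assms])
next
  case (Suc n)
  have "infinite (range g)"
    using assms by (simp add: range_inj_infinite strict_mono_imp_inj_on)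
  then show ?case
    unfolding enumerate_Suc''[OF \<open>infinite (range g)\<close>] Suc
    by (intro Least_equality)
      (auto simp: strict_mono_less[OF assms] strict_mono_less_eq[OF assms])
qed

text \<open>The \<open>L\<close> of the overview: each \<open>La\<close> has an image of length 2,
  each \<open>Lb\<close> of length 1. The counting form is what later evaluates
  \<open>L (L n)\<close>.\<close>

definition image_length :: "nat \<Rightarrow> nat" where
  "image_length n = n + card {i. i < n \<and> fib_word i = La}"

lemma image_length_0 [simp]: "image_length 0 = 0"
  by (simp add: image_length_def)

lemma image_length_Suc:
  "image_length (Suc n) = image_length n + (case fib_word n of La \<Rightarrow> 2 | Lb \<Rightarrow> 1)"
proof (cases "fib_word n")
  case La
  then have "{i. i < Suc n \<and> fib_word i = La} = insert n {i. i < n \<and> fib_word i = La}"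
    by (auto simp: less_Suc_eq)
  then show ?thesis using La by (simp add: image_length_def)
next
  case Lb
  then have "{i. i < Suc n \<and> fib_word i = La} = {i. i < n \<and> fib_word i = La}"
    by (auto simp: less_Suc_eq)
  then show ?thesis using Lb by (simp add: image_length_def)
qed

lemma strict_mono_image_length: "strict_mono image_length"
  by (simp add: strict_mono_Suc_iff image_length_Suc split: letter.split)

lemma length_subst_prefix:
  "length (subst_word fib_subst (map fib_word [0..<n])) = image_length n"
proof (induction n)
  case (Suc n)
  then show ?case
    by (cases "fib_word n") (simp_all add: subst_word_def image_length_Suc)
qed (simp add: subst_word_def)

text \<open>The fixed point property gives a prefix of some length; comparing lengths identifies
  it.\<close>

lemma subst_prefix:
  "subst_word fib_subst (map fib_word [0..<n]) = map fib_word [0..<image_length n]"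
  using fib_word_fixed_point[of n] length_subst_prefix[of n] by auto

text \<open>Cancel the image of the prefix of length n from that of the prefix of length n +
  1.\<close>

lemma subst_letter:
  "fib_subst (fib_word n) = map fib_word [image_length n..<image_length (Suc n)]"
proof -
  have le: "image_length n \<le> image_length (Suc n)"
    by (simp add: image_length_Suc)
  have "map fib_word [0..<image_length n] @ fib_subst (fib_word n)
      = subst_word fib_subst (map fib_word [0..<Suc n])"
    by (simp add: subst_word_append subst_prefix) (simp add: subst_word_def)
  also have "\<dots> = map fib_word [0..<image_length n]
      @ map fib_word [image_length n..<image_length (Suc n)]"
    using upt_add_eq_append[of 0 "image_length n" "image_length (Suc n) - image_length n"] le
    by (simp only: subst_prefix) simp
  finally show ?thesis by simp
qed

lemma fib_word_image_length: "fib_word (image_length n) = La"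
  using subst_letter[of n]
  by (cases "fib_word n") (simp_all add: image_length_Suc upt_rec)

lemma fib_word_Suc_image_length:
  "fib_word n = La \<Longrightarrow> fib_word (Suc (image_length n)) = Lb"
  using subst_letter[of n] by (simp add: image_length_Suc upt_rec)

text \<open>The blocks from \<open>image_length n\<close> to \<open>image_length (Suc n)\<close>
  partition the positions; a block has a second position only if it is the image of
  \<open>La\<close>.\<close>

lemma position_cases:
  obtains n where "i = image_length n"
  | n where "fib_word n = La" "i = Suc (image_length n)"
proof -
  have "\<exists>n. image_length n \<le> i \<and> i < image_length (Suc n)"
  proof (induction i)
    case 0
    have "0 < image_length (Suc 0)" by (simp add: image_length_Suc split: letter.split)
    then show ?case by (metis image_length_0 le_refl)
  next
    case (Suc i)
    then obtain n where n: "image_length n \<le> i" "i < image_length (Suc n)" by blast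
    \<comment> \<open>If \<open>Suc i\<close> leaves block n, it opens block n + 1, which is
      nonempty.\<close>
    have "image_length (Suc n) < image_length (Suc (Suc n))"
      using strict_mono_image_length by (simp add: strict_mono_Suc_iff)
    with n show ?case
      by (metis Suc_lessI le_Suc_eq le_refl)
  qed
  then obtain n where "image_length n \<le> i" "i < image_length (Suc n)" by blast
  then have "i = image_length n \<or> fib_word n = La \<and> i = Suc (image_length n)"
    by (auto simp: image_length_Suc split: letter.splits)
  with that show thesis by blast
qed

lemma fib_word_La_iff: "fib_word i = La \<longleftrightarrow> i \<in> range image_length"
proof
  assume "fib_word i = La"
  then show "i \<in> range image_length"
    by (cases i rule: position_cases) (auto dest: fib_word_Suc_image_length)
qed (auto simp: fib_word_image_length)

text \<open>An \<open>Lb\<close> directly follows some \<open>image_length m\<close> with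
  \<open>fib_word m = La\<close>, and such m are themselves values of
  \<open>image_length\<close>.\<close>

lemma positions_Lb:
  "{i. fib_word i = Lb} = range (\<lambda>n. Suc (image_length (image_length n)))"
proof (intro set_eqI iffI)
  fix i assume "i \<in> {i. fib_word i = Lb}"
  then show "i \<in> range (\<lambda>n. Suc (image_length (image_length n)))"
    by (cases i rule: position_cases) (auto simp: fib_word_image_length fib_word_La_iff)
qed (auto simp: fib_word_image_length fib_word_Suc_image_length)

lemma image_length_image_length: "image_length (image_length n) = image_length n + n"
proof -
  \<comment> \<open>By strict monotonicity, exactly the first n values of
    \<open>image_length\<close> lie below \<open>image_length n\<close>.\<close>
  have "{i. i < image_length n \<and> fib_word i = La} = image_length ` {..<n}"
    by (auto simp: fib_word_La_iff strict_mono_less[OF strict_mono_image_length])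
  then have "card {i. i < image_length n \<and> fib_word i = La} = n"
    using strict_mono_imp_inj_on[OF strict_mono_image_length]
    by (simp add: card_image inj_on_subset)
  then show ?thesis by (simp add: image_length_def[of "image_length n"])
qed

lemma p_a_eq: "p_a n = int (image_length (n - 1))"
  by (simp add: occ_pos_def fib_word_La_iff enumerate_range_strict_mono strict_mono_image_length)

lemma p_b_eq: "p_b n = int (image_length (n - 1) + (n - 1) + 1)"
proof -
  have "strict_mono (\<lambda>n. Suc (image_length (image_length n)))"
    using strict_mono_image_length by (simp add: strict_mono_def)
  then show ?thesis
    by (simp add: occ_pos_def positions_Lb enumerate_range_strict_mono image_length_image_length)
qed

theorem theorem4p2:
  shows "(\<forall>n\<ge>1. Delta p_a n = (case fib_word (n - 1) of La \<Rightarrow> 2 | Lb \<Rightarrow> 1)) \<and>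
         (\<forall>n\<ge>1. Delta p_b n = (case fib_word (n - 1) of La \<Rightarrow> 3 | Lb \<Rightarrow> 2)) \<and>
         (\<forall>n\<ge>1. r n = int n) \<and>
         (\<forall>n\<ge>1. Delta r n = 1) \<and>
         periodic_seq (Delta r)"
proof -
  have step: "image_length n
      = image_length (n - 1) + (case fib_word (n - 1) of La \<Rightarrow> 2 | Lb \<Rightarrow> 1)" if "n \<ge> 1" for n
    using that image_length_Suc[of "n - 1"] by simp
  have a: "\<forall>n\<ge>1. Delta p_a n = (case fib_word (n - 1) of La \<Rightarrow> 2 | Lb \<Rightarrow> 1)"
    by (auto simp: Delta_def p_a_eq step split: letter.split)
  \<comment> \<open>The extra summand n - 1 in \<open>p_b_eq\<close> raises each increment of
    \<open>p_a\<close> by one.\<close>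
  have b: "\<forall>n\<ge>1. Delta p_b n = (case fib_word (n - 1) of La \<Rightarrow> 3 | Lb \<Rightarrow> 2)"
    by (auto simp: Delta_def p_b_eq step of_nat_diff split: letter.split)
  \<comment> \<open>The terms \<open>image_length (n - 1)\<close> cancel, leaving (n - 1) +
    1.\<close>
  have r: "\<forall>n\<ge>1. r n = int n"
    by (auto simp: r_def p_a_eq p_b_eq)
  then have d: "\<forall>n\<ge>1. Delta r n = 1"
    by (simp add: Delta_def)
  then have "periodic_seq (Delta r)"
    unfolding periodic_seq_def by (intro exI[of _ 1]) simp
  with a b r d show ?thesis by blast
qed

end
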